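(* Let $G$ be a graph of treewidth at most $w$ and $R\subseteq V(G)$ a set of terminals with $|R|\ge w+1$. Then every Pendant $R$-CIST of $G$ has size at most $w$.
   Context: Graphs are finite and connected, may have parallel edges but no loops; treewidth is the usual treewidth (of the underlying simple graph). For a tree $T$, $\mathrm{int}(T)$ is the set of vertices of degree at least 2 and $L(T)$ the set of leaves. An $R$-Steiner tree is a subtree $T$ with $R\subseteq V(T)$ and $L(T)\subseteq R$; it is pendant if $L(T)=R$. $T(u,v)$ is the unique $(u,v)$-path in $T$. An $R$-CIST of size $k$ is a set $\{T_1,\dots,T_k\}$ of $R$-Steiner trees such that for all distinct $u,v\in R$ and distinct $i,j$, $T_i(u,v)$ and $T_j(u,v)$ are edge-disjoint and internally vertex-disjoint; it is a Pendant $R$-CIST if all its trees are pendant.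
   Formalization: For w = 1 and |R| = 2 it is additionally assumed that at most one edge joins the two terminals; otherwise the claim fails, since two parallel edges between the terminals form a Pendant R-CIST of size 2 in a graph of treewidth 1. *)

theory Defs
  imports Main
begin

record ('v, 'e) mgraph =
  verts :: "'v set"
  edges :: "'e set"
  ends  :: "'e \<Rightarrow> 'v set"

text \<open>Parallel edges are distinct edges with the same pair of ends; \<open>card = 2\<close> excludes loops.\<close>

definition multigraph :: "('v, 'e) mgraph \<Rightarrow> bool" where
  "multigraph G \<longleftrightarrow> finite (verts G) \<and> finite (edges G) \<and>
     (\<forall>e\<in>edges G. ends G e \<subseteq> verts G \<and> card (ends G e) = 2)"

definition degree :: "('v, 'e) mgraph \<Rightarrow> 'v \<Rightarrow> nat" where
  "degree G v = card {e \<in> edges G. v \<in> ends G e}"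

text \<open>A path is given by its vertex sequence \<open>vs\<close> together with its edge sequence \<open>es\<close>, since
  the vertex sequence alone does not determine a path in the presence of parallel edges.\<close>

definition is_path :: "('v, 'e) mgraph \<Rightarrow> 'v \<Rightarrow> 'v \<Rightarrow> 'v list \<times> 'e list \<Rightarrow> bool" where
  "is_path G u v p \<longleftrightarrow> (case p of (vs, es) \<Rightarrow>
     length vs = length es + 1 \<and> distinct vs \<and> set vs \<subseteq> verts G \<and> set es \<subseteq> edges G \<and>
     hd vs = u \<and> last vs = v \<and>
     (\<forall>i < length es. ends G (es ! i) = {vs ! i, vs ! Suc i}))"

definition connected_graph :: "('v, 'e) mgraph \<Rightarrow> bool" where
  "connected_graph G \<longleftrightarrow> verts G \<noteq> {} \<and> (\<forall>u\<in>verts G. \<forall>v\<in>verts G. \<exists>p. is_path G u v p)"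

text \<open>Two parallel edges form a cycle of length 2.\<close>

definition is_cycle :: "('v, 'e) mgraph \<Rightarrow> 'v list \<times> 'e list \<Rightarrow> bool" where
  "is_cycle G c \<longleftrightarrow> (case c of (vs, es) \<Rightarrow>
     length vs = length es \<and> 2 \<le> length es \<and> distinct vs \<and> distinct es \<and>
     set vs \<subseteq> verts G \<and> set es \<subseteq> edges G \<and>
     (\<forall>i < length es. ends G (es ! i) = {vs ! i, vs ! (Suc i mod length vs)}))"

definition is_tree :: "('v, 'e) mgraph \<Rightarrow> bool" where
  "is_tree T \<longleftrightarrow> multigraph T \<and> connected_graph T \<and> \<not> (\<exists>c. is_cycle T c)"

text \<open>Leaves have degree exactly 1, so the one-vertex tree has no leaf.\<close>

definition leaves :: "('v, 'e) mgraph \<Rightarrow> 'v set" where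
  "leaves T = {v \<in> verts T. degree T v = 1}"

definition tree_path :: "('v, 'e) mgraph \<Rightarrow> 'v \<Rightarrow> 'v \<Rightarrow> 'v list \<times> 'e list" where
  "tree_path T u v = (THE p. is_path T u v p)"

text \<open>Requiring equality of the functions \<open>ends\<close>, also outside \<open>edges H\<close>, makes a subgraph
  of \<open>G\<close> determined by its vertices and edges, so that sets of subgraphs are counted correctly.\<close>

definition subgraph :: "('v, 'e) mgraph \<Rightarrow> ('v, 'e) mgraph \<Rightarrow> bool" where
  "subgraph H G \<longleftrightarrow>
     multigraph H \<and> verts H \<subseteq> verts G \<and> edges H \<subseteq> edges G \<and> ends H = ends G"

definition induced_subgraph :: "('v, 'e) mgraph \<Rightarrow> 'v set \<Rightarrow> ('v, 'e) mgraph" where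
  "induced_subgraph G X =
     \<lparr>verts = verts G \<inter> X, edges = {e \<in> edges G. ends G e \<subseteq> X}, ends = ends G\<rparr>"

text \<open>The edge condition only concerns which pairs of vertices are adjacent: this is a tree
  decomposition of the underlying simple graph.\<close>

definition tree_decomposition ::
    "('v, 'e) mgraph \<Rightarrow> ('t, 'd) mgraph \<Rightarrow> ('t \<Rightarrow> 'v set) \<Rightarrow> bool" where
  "tree_decomposition G T bag \<longleftrightarrow> is_tree T \<and>
     (\<Union>t\<in>verts T. bag t) = verts G \<and>
     (\<forall>e\<in>edges G. \<exists>t\<in>verts T. ends G e \<subseteq> bag t) \<and>
     (\<forall>v\<in>verts G. connected_graph (induced_subgraph T {t. v \<in> bag t}))"

definition decomposition_width :: "('t, 'd) mgraph \<Rightarrow> ('t \<Rightarrow> 'v set) \<Rightarrow> nat" where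
  "decomposition_width T bag = Max ((\<lambda>t. card (bag t)) ` verts T) - 1"

text \<open>Every finite tree is isomorphic to one with nodes and edges in \<open>nat\<close>. The truncated
  subtraction in the width only matters for the graph without vertices.\<close>

definition treewidth :: "('v, 'e) mgraph \<Rightarrow> nat" where
  "treewidth G = (LEAST k. \<exists>(T :: (nat, nat) mgraph) bag.
     tree_decomposition G T bag \<and> decomposition_width T bag = k)"

definition steiner_tree :: "('v, 'e) mgraph \<Rightarrow> 'v set \<Rightarrow> ('v, 'e) mgraph \<Rightarrow> bool" where
  "steiner_tree G R T \<longleftrightarrow> subgraph T G \<and> is_tree T \<and> R \<subseteq> verts T \<and> leaves T \<subseteq> R"

definition pendant :: "'v set \<Rightarrow> ('v, 'e) mgraph \<Rightarrow> bool" where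
  "pendant R T \<longleftrightarrow> leaves T = R"

definition edge_disjoint :: "'v list \<times> 'e list \<Rightarrow> 'v list \<times> 'e list \<Rightarrow> bool" where
  "edge_disjoint p q \<longleftrightarrow> set (snd p) \<inter> set (snd q) = {}"

definition inner_verts :: "'v list \<times> 'e list \<Rightarrow> 'v set" where
  "inner_verts p = set (fst p) - {hd (fst p), last (fst p)}"

definition internally_disjoint :: "'v list \<times> 'e list \<Rightarrow> 'v list \<times> 'e list \<Rightarrow> bool" where
  "internally_disjoint p q \<longleftrightarrow> inner_verts p \<inter> inner_verts q = {}"

definition CIST :: "('v, 'e) mgraph \<Rightarrow> 'v set \<Rightarrow> ('v, 'e) mgraph set \<Rightarrow> bool" where
  "CIST G R \<T> \<longleftrightarrow> finite \<T> \<and> (\<forall>T\<in>\<T>. steiner_tree G R T) \<and>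
     (\<forall>u\<in>R. \<forall>v\<in>R. u \<noteq> v \<longrightarrow> (\<forall>S\<in>\<T>. \<forall>T\<in>\<T>. S \<noteq> T \<longrightarrow>
        edge_disjoint (tree_path S u v) (tree_path T u v) \<and>
        internally_disjoint (tree_path S u v) (tree_path T u v)))"

definition pendant_CIST :: "('v, 'e) mgraph \<Rightarrow> 'v set \<Rightarrow> ('v, 'e) mgraph set \<Rightarrow> bool" where
  "pendant_CIST G R \<T> \<longleftrightarrow> CIST G R \<T> \<and> (\<forall>T\<in>\<T>. pendant R T)"

end

theory Submission imports Defs begin

text \<open>A minor of a graph of treewidth at most \<open>w\<close> has a vertex of degree at most \<open>w\<close>: the
  branch sets span subtrees of the decomposition tree, and for a subtree whose topmost node is
  deepest, the bag of this node meets the branch set and all its neighbours. The sets of inner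
  vertices of the trees of a pendant CIST are connected and pairwise disjoint, and unless a tree is
  a single edge each of them is adjacent to every terminal. Together with the terminals, more than
  \<open>w\<close> of them would yield a minor of minimum degree greater than \<open>w\<close>. A tree that is a single edge
  forces \<open>R\<close> to consist of its two ends, and then an edge or a triangle serves as the minor.\<close>

section \<open>Adjacency and reachability\<close>

definition adj :: "('v, 'e) mgraph \<Rightarrow> ('v \<times> 'v) set" where
  "adj G = {(a, b). \<exists>e\<in>edges G. ends G e = {a, b}}"

text \<open>The set \<open>X\<close> is arbitrary, so \<open>- {t}\<close> expresses deletion of a
  vertex without forming a new graph. Every vertex reaches itself, even outside
  \<open>X\<close>.\<close>

definition reach :: "('v, 'e) mgraph \<Rightarrow> 'v set \<Rightarrow> ('v \<times> 'v) set" where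
  "reach G X = (adj G \<inter> X \<times> X)\<^sup>*"

text \<open>The empty set counts as connected, which is why nonemptiness is demanded separately of
  branch sets and subtrees.\<close>

definition connected_in :: "('v, 'e) mgraph \<Rightarrow> 'v set \<Rightarrow> bool" where
  "connected_in G X \<longleftrightarrow> X \<times> X \<subseteq> reach G X"

lemma adj_sym: "(a, b) \<in> adj G \<Longrightarrow> (b, a) \<in> adj G"
  unfolding adj_def by (auto simp: insert_commute)

lemma adjD:
  assumes "multigraph G" "(a, b) \<in> adj G"
  shows "a \<in> verts G" "b \<in> verts G" "a \<noteq> b"
  using assms unfolding adj_def multigraph_def by fastforce+

lemma edge_at:
  assumes "multigraph G" "e \<in> edges G" "v \<in> ends G e"
  obtains y where "ends G e = {v, y}" "y \<noteq> v" "(v, y) \<in> adj G"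
proof -
  have "card (ends G e) = 2" using assms unfolding multigraph_def by blast
  then obtain a b where ab: "ends G e = {a, b}" "a \<noteq> b" by (auto simp: card_2_iff)
  with assms(3) have "\<exists>y. ends G e = {v, y} \<and> y \<noteq> v" by (auto simp: insert_commute)
  then show ?thesis using that assms(2) unfolding adj_def by blast
qed

lemma reach_refl: "(x, x) \<in> reach G X"
  unfolding reach_def by simp

lemma reach_sym: "(x, y) \<in> reach G X \<Longrightarrow> (y, x) \<in> reach G X"
proof -
  have "sym (adj G \<inter> X \<times> X)" by (auto intro: symI adj_sym)
  then show "(x, y) \<in> reach G X \<Longrightarrow> (y, x) \<in> reach G X"
    unfolding reach_def by (metis sym_rtrancl symD)
qed

lemma reach_trans: "(x, y) \<in> reach G X \<Longrightarrow> (y, z) \<in> reach G X \<Longrightarrow> (x, z) \<in> reach G X"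
  unfolding reach_def by simp

lemma reach_mono:
  assumes "adj H \<subseteq> adj G" "X \<subseteq> Y" shows "reach H X \<subseteq> reach G Y"
  unfolding reach_def using assms by (intro rtrancl_mono) auto

lemma reach_adj: "(x, y) \<in> adj G \<Longrightarrow> x \<in> X \<Longrightarrow> y \<in> X \<Longrightarrow> (x, y) \<in> reach G X"
  unfolding reach_def by auto

lemma reach_induct [consumes 1, case_names refl step]:
  assumes "(x, y) \<in> reach G X" "P x"
    and "\<And>a b. (x, a) \<in> reach G X \<Longrightarrow> (a, b) \<in> adj G \<Longrightarrow> a \<in> X \<Longrightarrow> b \<in> X \<Longrightarrow> P a \<Longrightarrow> P b"
  shows "P y"
  using assms(1) unfolding reach_def
  by (induction rule: rtrancl_induct) (use assms(2,3) in \<open>auto simp: reach_def\<close>)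

lemma connected_inD: "connected_in G X \<Longrightarrow> x \<in> X \<Longrightarrow> y \<in> X \<Longrightarrow> (x, y) \<in> reach G X"
  unfolding connected_in_def by auto

text \<open>Serves to show that a connected set which meets a branch of a tree and also leaves it
  contains the root of the branch.\<close>

lemma reach_crossing:
  assumes "(x, y) \<in> reach G X" "x \<in> D" "y \<notin> D"
  obtains a b where "(a, b) \<in> adj G" "a \<in> X" "a \<in> D" "b \<notin> D"
proof -
  have "y \<notin> D \<longrightarrow> (\<exists>a b. (a, b) \<in> adj G \<and> a \<in> X \<and> a \<in> D \<and> b \<notin> D)"
    using assms(1) by (induction rule: reach_induct) (use assms(2) in auto)
  then show ?thesis using that assms(3) by blast
qed

section \<open>Paths\<close>

lemma is_path_single:
  "is_path G u v ([x], es) \<longleftrightarrow> es = [] \<and> x = u \<and> x = v \<and> x \<in> verts G"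
  unfolding is_path_def by auto

lemma is_path_Cons_Cons:
  "is_path G u v (x # y # vs, e # es) \<longleftrightarrow>
     x = u \<and> x \<notin> set (y # vs) \<and> x \<in> verts G \<and> e \<in> edges G \<and> ends G e = {x, y} \<and>
     is_path G y v (y # vs, es)"
  unfolding is_path_def by (auto simp: All_less_Suc2)

lemma is_path_nonempty: "is_path G u v (vs, es) \<Longrightarrow> vs \<noteq> []"
  unfolding is_path_def by auto

lemma is_path_last: "is_path G u v (vs, es) \<Longrightarrow> v \<in> set vs"
  unfolding is_path_def by (cases vs rule: rev_cases) auto

lemma is_path_cases:
  assumes "is_path G u v (vs, es)"
  obtains (single) "vs = [u]" "es = []" "u = v" "u \<in> verts G"
  | (step) y vs' e es' where "vs = u # y # vs'" "es = e # es'" "u \<notin> set (y # vs')"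
      "u \<in> verts G" "e \<in> edges G" "ends G e = {u, y}" "is_path G y v (y # vs', es')"
proof (cases vs)
  case Nil then show ?thesis using is_path_nonempty[OF assms] by simp
next
  case (Cons x xs)
  show ?thesis
  proof (cases xs)
    case Nil
    then have "is_path G u v ([x], es)" using assms Cons by simp
    then have "es = []" "x = u" "u = v" "u \<in> verts G" unfolding is_path_single by auto
    then show ?thesis using Cons Nil by (intro single) auto
  next
    case C2: (Cons y ys)
    have "length es = Suc (length ys)" using assms Cons C2 unfolding is_path_def by auto
    then obtain e es' where es: "es = e # es'" by (cases es) auto
    have "is_path G u v (x # y # ys, e # es')" using assms Cons C2 es by simp
    then have *: "x = u" "x \<notin> set (y # ys)" "x \<in> verts G" "e \<in> edges G" "ends G e = {x, y}"
      "is_path G y v (y # ys, es')"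
      unfolding is_path_Cons_Cons by blast+
    show ?thesis by (rule step) (use * Cons C2 es in auto)
  qed
qed

lemma path_induct [consumes 1, case_names single step]:
  assumes "is_path G u v (vs, es)"
    and "\<And>v. v \<in> verts G \<Longrightarrow> P v v [v] []"
    and "\<And>u y v vs e es. u \<notin> set (y # vs) \<Longrightarrow> u \<in> verts G \<Longrightarrow> e \<in> edges G \<Longrightarrow>
      ends G e = {u, y} \<Longrightarrow> is_path G y v (y # vs, es) \<Longrightarrow> P y v (y # vs) es \<Longrightarrow>
      P u v (u # y # vs) (e # es)"
  shows "P u v vs es"
  using assms(1)
proof (induction vs arbitrary: u es)
  case Nil then show ?case using is_path_nonempty by metis
next
  case (Cons x xs)
  from Cons.prems show ?case
    by (cases rule: is_path_cases) (use assms(2,3) Cons.IH in auto)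
qed

lemma path_reach:
  assumes "is_path G u v (vs, es)" "set vs \<subseteq> X"
  shows "(u, v) \<in> reach G X"
  using assms
proof (induction rule: path_induct)
  case (step u y v vs e es)
  have "(u, y) \<in> adj G" using step unfolding adj_def by auto
  then show ?case using step by (meson reach_adj reach_trans list.set_intros subsetD set_subset_Cons subset_trans)
qed (simp add: reach_refl)

lemma path_edge_ends:
  assumes "is_path G u v (vs, es)" "e \<in> set es"
  shows "ends G e \<subseteq> set vs"
  using assms by (induction rule: path_induct) auto

lemma path_distinct_edges:
  assumes "is_path G u v (vs, es)"
  shows "distinct es"
  using assms
proof (induction rule: path_induct)
  case (step u y v vs e es)
  then show ?case using path_edge_ends by fastforce
qed auto

text \<open>Provides the shortcut in \<open>reach_path\<close> when a walk returns to a vertex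
  already on the path.\<close>

lemma path_suffix:
  assumes "is_path G u v (vs, es)" "z \<in> set vs"
  shows "\<exists>vs' es'. is_path G z v (vs', es') \<and> set vs' \<subseteq> set vs"
  using assms
proof (induction rule: path_induct)
  case (single v)
  then have "is_path G z v ([v], [])" by (auto simp: is_path_single)
  then show ?case using single by fastforce
next
  case (step u y v vs e es)
  show ?case
  proof (cases "z = u")
    case True
    then have "is_path G z v (u # y # vs, e # es)" using step by (simp add: is_path_Cons_Cons)
    then show ?thesis by blast
  next
    case False
    then show ?thesis using step by (metis set_ConsD set_subset_Cons subset_trans)
  qed
qed

text \<open>The path runs backwards because the induction extends the walk at its far end, whereas
  lists grow at the head.\<close>

lemma reach_path:
  assumes "(u, v) \<in> reach G X" "u \<in> X" "multigraph G" "u \<in> verts G"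
  shows "\<exists>vs es. is_path G v u (vs, es) \<and> set vs \<subseteq> X"
  using assms(1)
proof (induction rule: reach_induct)
  case refl
  have "is_path G u u ([u], [])" using assms by (simp add: is_path_single)
  then show ?case using assms(2) by (metis empty_set list.simps(15) empty_subsetI insert_subset)
next
  case (step a b)
  then obtain vs es where p: "is_path G a u (vs, es)" "set vs \<subseteq> X" by blast
  show ?case
  proof (cases "b \<in> set vs")
    case True then show ?thesis using path_suffix p by (meson subset_trans)
  next
    case False
    obtain e where e: "e \<in> edges G" "ends G e = {b, a}"
      using step(2) unfolding adj_def by (auto simp: insert_commute)
    have b: "b \<in> verts G" using adjD step(2) assms(3) by metis
    obtain vs' where vs': "vs = a # vs'" using p(1) by (cases rule: is_path_cases) auto
    have "is_path G b u (b # vs, e # es)"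
      unfolding vs' is_path_Cons_Cons using False p e b vs' by auto
    then show ?thesis using p(2) step(4) by (metis insert_subset list.simps(15))
  qed
qed

lemma connected_graph_path:
  assumes "connected_graph G" "u \<in> verts G" "v \<in> verts G"
  obtains vs es where "is_path G u v (vs, es)"
proof -
  obtain p where "is_path G u v p" using assms unfolding connected_graph_def by blast
  then show ?thesis using that by (cases p) auto
qed

lemma connected_graph_imp:
  assumes "connected_graph G"
  shows "connected_in G (verts G)"
proof -
  have "(x, y) \<in> reach G (verts G)" if xy: "x \<in> verts G" "y \<in> verts G" for x y
  proof -
    obtain vs es where "is_path G x y (vs, es)"
      using assms xy by (rule connected_graph_path)
    moreover from this have "set vs \<subseteq> verts G" unfolding is_path_def by auto
    ultimately show ?thesis by (rule path_reach)
  qed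
  then show ?thesis unfolding connected_in_def by auto
qed

text \<open>The neighbours are the predecessor and the successor on the path. Hence a leaf is never
  an inner vertex of a path.\<close>

lemma path_inner_nbrs:
  assumes "is_path G u v (vs, es)" "z \<in> set vs" "z \<noteq> u" "z \<noteq> v"
  obtains a b where "(z, a) \<in> adj G" "(z, b) \<in> adj G" "a \<noteq> b"
proof -
  have p: "length vs = length es + 1" "distinct vs" "set es \<subseteq> edges G" "hd vs = u" "last vs = v"
    "\<And>i. i < length es \<Longrightarrow> ends G (es ! i) = {vs ! i, vs ! Suc i}"
    using assms(1) unfolding is_path_def by auto
  obtain i where i: "i < length vs" "z = vs ! i" using assms(2) by (auto simp: in_set_conv_nth)
  have ne: "vs \<noteq> []" using i by auto
  have "i \<noteq> 0" using i assms(3) p(4) ne by (metis hd_conv_nth)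
  then obtain j where j: "i = Suc j" by (cases i) auto
  have "i \<noteq> length es" using i assms(4) p(1,5) ne by (auto simp: last_conv_nth)
  then have il: "i < length es" using i p(1) by auto
  have edge: "es ! k \<in> edges G" if "k < length es" for k using p(3) that nth_mem by blast
  have "(z, vs ! j) \<in> adj G"
    unfolding adj_def using p(6)[of j] il j i edge[of j] by (auto simp: insert_commute)
  moreover have "(z, vs ! Suc i) \<in> adj G"
    unfolding adj_def using p(6)[of i] il i edge[of i] by auto
  moreover have "vs ! j \<noteq> vs ! Suc i"
    using p(1,2) il j by (subst nth_eq_iff_index_eq) auto
  ultimately show ?thesis using that by blast
qed

section \<open>Trees\<close>

text \<open>A path from \<open>c\<close> to \<open>d\<close> that avoids \<open>t\<close> would
  close to a cycle through \<open>t\<close>. So distinct neighbours of \<open>t\<close> lie in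
  different components of the tree without \<open>t\<close>; most facts about trees below rest on
  this.\<close>

lemma tree_no_bypass:
  assumes "is_tree T" "(t, c) \<in> adj T" "(t, d) \<in> adj T" "(c, d) \<in> reach T (- {t})"
  shows "c = d"
proof (rule ccontr)
  assume ne: "c \<noteq> d"
  have m: "multigraph T" using assms(1) unfolding is_tree_def by blast
  note c = adjD[OF m assms(2)] and d = adjD[OF m assms(3)]
  obtain vs es where p: "is_path T c d (vs, es)" "set vs \<subseteq> - {t}"
    using reach_path[OF reach_sym[OF assms(4)]] m c d by auto
  obtain e where e: "e \<in> edges T" "ends T e = {t, c}" using assms(2) unfolding adj_def by auto
  obtain f where f: "f \<in> edges T" "ends T f = {t, d}" using assms(3) unfolding adj_def by auto
  have q: "length vs = length es + 1" "distinct vs" "set vs \<subseteq> verts T" "set es \<subseteq> edges T"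
    "hd vs = c" "last vs = d"
    "\<And>i. i < length es \<Longrightarrow> ends T (es ! i) = {vs ! i, vs ! Suc i}"
    using p(1) unfolding is_path_def by auto
  have vs0: "vs ! 0 = c" and vsl: "vs ! length es = d"
    using q(1,5,6) by (auto simp: hd_conv_nth last_conv_nth simp flip: length_greater_0_conv)
  have "e \<notin> set es" "f \<notin> set es" "e \<noteq> f"
    using path_edge_ends[OF p(1)] p(2) e f ne by (auto simp: doubleton_eq_iff)
  then have dist: "distinct (e # es @ [f])" using path_distinct_edges[OF p(1)] by auto
  have "is_cycle T (t # vs, e # es @ [f])"
    unfolding is_cycle_def prod.case
  proof (intro conjI allI impI)
    fix i assume i: "i < length (e # es @ [f])"
    \<comment> \<open>The cases are the edge \<open>e\<close>, the edges of the path, and the edge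
      \<open>f\<close>, where alone the index wraps around to \<open>t\<close>.\<close>
    consider "i = 0" | j where "i = Suc j" "j < length es" | "i = Suc (length es)"
      using i by (cases i) (auto simp: less_Suc_eq)
    then show "ends T ((e # es @ [f]) ! i) = {(t # vs) ! i, (t # vs) ! (Suc i mod length (t # vs))}"
      by cases (use q(1,7) vs0 vsl e f in \<open>auto simp: nth_append\<close>)
  qed (use q p(2) e f d dist in auto)
  then show False using assms(1) unfolding is_tree_def by blast
qed

text \<open>Two parallel edges would be a cycle of length 2.\<close>

lemma tree_no_parallel:
  assumes "is_tree T" "e \<in> edges T" "f \<in> edges T" "ends T e = ends T f"
  shows "e = f"
proof (rule ccontr)
  assume ne: "e \<noteq> f"
  have m: "ends T e \<subseteq> verts T" "card (ends T e) = 2"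
    using assms(1,2) unfolding is_tree_def multigraph_def by auto
  then obtain a b where "ends T e = {a, b}" "a \<noteq> b" by (auto simp: card_2_iff)
  then have "is_cycle T ([a, b], [e, f])"
    using m assms ne unfolding is_cycle_def by (auto simp: less_Suc_eq insert_commute)
  then show False using assms(1) unfolding is_tree_def by blast
qed

text \<open>Induction along the first path: the second vertices of both paths are neighbours of
  \<open>u\<close> joined through \<open>v\<close> while avoiding \<open>u\<close>, so they agree by
  \<open>tree_no_bypass\<close>.\<close>

lemma tree_path_unique:
  assumes "is_path T u v (vs, es)" "is_tree T" "is_path T u v (vs', es')"
  shows "vs' = vs \<and> es' = es"
  using assms(1,3)
proof (induction arbitrary: vs' es' rule: path_induct)
  case (single v)
  from single(2) show ?case
  proof (cases rule: is_path_cases)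
    case (step y ws f fs)
    then show ?thesis using is_path_last by metis
  qed auto
next
  case (step u y v vs e es)
  have uv: "u \<noteq> v" using step(1) is_path_last[OF step(5)] by blast
  from step(7) show ?case
  proof (cases rule: is_path_cases)
    case (step z ws f fs)
    have "(y, v) \<in> reach T (- {u})" "(z, v) \<in> reach T (- {u})"
      using step step.hyps(1,5) path_reach[of T _ v _ _ "- {u}"] by auto
    then have "(y, z) \<in> reach T (- {u})" by (metis reach_sym reach_trans)
    moreover have "(u, y) \<in> adj T" "(u, z) \<in> adj T"
      using step step.hyps unfolding adj_def by auto
    ultimately have "y = z" using tree_no_bypass assms(2) by metis
    moreover from this have "e = f" using tree_no_parallel[OF assms(2)] step step.hyps by metis
    ultimately show ?thesis using step step.IH by auto
  qed (use uv in auto)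
qed

text \<open>Existence and uniqueness give the definite description in \<open>tree_path\<close> its
  meaning.\<close>

lemma tree_path_is_path:
  assumes "is_tree T" "u \<in> verts T" "v \<in> verts T"
  shows "is_path T u v (tree_path T u v)"
proof -
  obtain p where "is_path T u v p"
    using assms unfolding is_tree_def connected_graph_def by blast
  moreover have "q = p" if "is_path T u v q" for q
    using tree_path_unique[of T u v "fst p" "snd p" "fst q" "snd q"] that calculation assms(1)
    by (simp add: prod_eq_iff)
  ultimately show ?thesis unfolding tree_path_def by (rule theI)
qed

section \<open>Leaves and inner vertices of a tree\<close>

text \<open>\<open>degree\<close> counts edges, not neighbours; the two agree here because a tree
  has no parallel edges.\<close>

lemma leafI:
  assumes "is_tree T" "(c, x) \<in> adj T" "\<And>y. (c, y) \<in> adj T \<Longrightarrow> y = x"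
  shows "c \<in> leaves T"
proof -
  have m: "multigraph T" using assms(1) unfolding is_tree_def by blast
  obtain e where e: "e \<in> edges T" "ends T e = {c, x}" using assms(2) unfolding adj_def by auto
  have "f = e" if "f \<in> edges T" "c \<in> ends T f" for f
  proof -
    obtain y where "ends T f = {c, y}" "(c, y) \<in> adj T" using edge_at m \<open>f \<in> edges T\<close> \<open>c \<in> ends T f\<close> by metis
    then show ?thesis using assms e that tree_no_parallel by metis
  qed
  moreover have "c \<in> ends T e" using e(2) by simp
  ultimately have "{f \<in> edges T. c \<in> ends T f} = {e}" using e(1) by blast
  then show ?thesis using adjD[OF m assms(2)] unfolding leaves_def degree_def by auto
qed

lemma leaf_edge:
  assumes "v \<in> leaves T"
  obtains e where "e \<in> edges T" "v \<in> ends T e" "\<And>f. f \<in> edges T \<Longrightarrow> v \<in> ends T f \<Longrightarrow> f = e"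
proof -
  have "card {f \<in> edges T. v \<in> ends T f} = 1"
    using assms unfolding leaves_def degree_def by blast
  then obtain e where "{f \<in> edges T. v \<in> ends T f} = {e}" by (rule card_1_singletonE)
  then show ?thesis using that by blast
qed

lemma leaf_nbr:
  assumes "multigraph T" "v \<in> leaves T"
  obtains x where "(v, x) \<in> adj T"
  using assms by (metis leaf_edge edge_at)

lemma leaf_nbr_unique:
  assumes "v \<in> leaves T" "(v, a) \<in> adj T" "(v, b) \<in> adj T"
  shows "a = b"
proof -
  obtain e f where e: "e \<in> edges T" "ends T e = {v, a}" "f \<in> edges T" "ends T f = {v, b}"
    using assms(2,3) unfolding adj_def by auto
  then have "e = f" using leaf_edge[OF assms(1)] by (metis insertI1)
  then show ?thesis using e by (auto simp: doubleton_eq_iff)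
qed

text \<open>Walking on from \<open>c\<close>, away from \<open>x\<close>, strictly shrinks the part
  of the tree ahead, so the walk ends at a vertex with no way onward, a leaf.\<close>

lemma leaf_beyond:
  assumes "is_tree T" "(x, c) \<in> adj T"
  shows "\<exists>z\<in>leaves T. (c, z) \<in> reach T (- {x})"
  using assms(2)
proof (induction "card {y. (c, y) \<in> reach T (- {x})}" arbitrary: x c rule: less_induct)
  case less
  have m: "multigraph T" using assms(1) unfolding is_tree_def by blast
  note cx = adjD[OF m less(2)]
  have "{y. (c, y) \<in> reach T (- {x})} \<subseteq> verts T"
  proof
    fix y assume "y \<in> {y. (c, y) \<in> reach T (- {x})}"
    then have "(c, y) \<in> reach T (- {x})" by simp
    then show "y \<in> verts T" by (induction rule: reach_induct) (use cx adjD m in metis)+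
  qed
  then have fin: "finite {y. (c, y) \<in> reach T (- {x})}"
    using m unfolding multigraph_def by (meson finite_subset)
  show ?case
  proof (cases "\<exists>d. (c, d) \<in> adj T \<and> d \<noteq> x")
    case False
    then have "c \<in> leaves T" using leafI[OF assms(1) adj_sym[OF less(2)]] by blast
    then show ?thesis using reach_refl by metis
  next
    case True
    then obtain d where d: "(c, d) \<in> adj T" "d \<noteq> x" by blast
    \<comment> \<open>The part beyond \<open>d\<close> lies in the part beyond \<open>c\<close>: a
      walk from \<open>d\<close> avoiding \<open>c\<close> cannot reach \<open>x\<close>, another
      neighbour of \<open>c\<close>. It misses \<open>c\<close>, so the inclusion is strict.\<close>
    have sub: "(c, y) \<in> reach T (- {x}) \<and> y \<noteq> x \<and> y \<noteq> c" if "(d, y) \<in> reach T (- {c})" for y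
      using that
    proof (induction rule: reach_induct)
      case refl
      show ?case using d cx adjD[OF m d(1)] by (auto intro: reach_adj)
    next
      case (step a b)
      have "(d, b) \<in> reach T (- {c})" using step reach_adj reach_trans by metis
      then have "b \<noteq> x" using tree_no_bypass[OF assms(1) d(1) adj_sym[OF less(2)]] d(2) by blast
      moreover have "b \<noteq> c" using step by auto
      moreover have "(a, b) \<in> reach T (- {x})" using step \<open>b \<noteq> x\<close> by (auto intro: reach_adj)
      ultimately show ?case using step reach_trans by metis
    qed
    have "{y. (d, y) \<in> reach T (- {c})} \<subset> {y. (c, y) \<in> reach T (- {x})}"
      using sub reach_refl[of c T "- {x}"] by blast
    then have "\<exists>z\<in>leaves T. (d, z) \<in> reach T (- {c})"
      using less(1) d(1) fin psubset_card_mono by blast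
    then show ?thesis using sub by blast
  qed
qed

text \<open>A path between two non-leaves contains no leaf, since its inner vertices have two
  neighbours each.\<close>

lemma connected_in_inner:
  assumes "is_tree T"
  shows "connected_in T (verts T - leaves T)"
proof -
  have "(x, y) \<in> reach T (verts T - leaves T)"
    if xy: "x \<in> verts T - leaves T" "y \<in> verts T - leaves T" for x y
  proof -
    obtain vs es where p: "is_path T x y (vs, es)"
      using assms xy connected_graph_path unfolding is_tree_def by (metis DiffD1)
    have "z \<notin> leaves T" if "z \<in> set vs" for z
      using path_inner_nbrs[OF p that] leaf_nbr_unique xy by (metis DiffD2)
    moreover have "set vs \<subseteq> verts T" using p unfolding is_path_def by auto
    ultimately have "set vs \<subseteq> verts T - leaves T" by blast
    then show ?thesis using path_reach[OF p] by metis
  qed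
  then show ?thesis unfolding connected_in_def by auto
qed

section \<open>Subtrees of a tree and treewidth\<close>

text \<open>\<open>D\<close> is a branch of \<open>T\<close> with root \<open>t\<close>. In a smallest branch that contains a member of the
  family, the root lies in every member inside the branch, since otherwise one could pass to a
  component of \<open>D - {t}\<close>; members that leave the branch pass through the root anyway.\<close>

lemma subtree_family_simplicial:
  assumes "is_tree T" "finite D" "t \<in> D" "\<And>a b. (a, b) \<in> adj T \<Longrightarrow> a \<in> D \<Longrightarrow> b \<notin> D \<Longrightarrow> a = t"
    and "\<And>S. S \<in> \<F> \<Longrightarrow> connected_in T S \<and> S \<noteq> {}" and "\<exists>S\<in>\<F>. S \<subseteq> D"
  shows "\<exists>S\<in>\<F>. \<exists>z\<in>S. \<forall>S'\<in>\<F>. S' \<inter> S \<noteq> {} \<longrightarrow> z \<in> S'"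
  using assms(2,3,4,6)
proof (induction D arbitrary: t rule: finite_psubset_induct)
  case (psubset D)
  note boundary = psubset.prems(2)
  show ?case
  proof (cases "\<forall>S\<in>\<F>. S \<subseteq> D \<longrightarrow> t \<in> S")
    case True
    obtain S where S: "S \<in> \<F>" "S \<subseteq> D" using psubset.prems(3) by blast
    have "t \<in> S'" if S': "S' \<in> \<F>" "S' \<inter> S \<noteq> {}" for S'
    proof (cases "S' \<subseteq> D")
      case True then show ?thesis using \<open>\<forall>S\<in>\<F>. S \<subseteq> D \<longrightarrow> t \<in> S\<close> S' by blast
    next
      case False
      obtain x y where xy: "x \<in> S'" "x \<in> D" "y \<in> S'" "y \<notin> D" using S' S(2) False by blast
      then obtain a b where "(a, b) \<in> adj T" "a \<in> S'" "a \<in> D" "b \<notin> D"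
        using reach_crossing[of x y T S' D] connected_inD assms(5) S'(1) by metis
      then show ?thesis using boundary by blast
    qed
    then show ?thesis using S True by (intro bexI[of _ S] bexI[of _ t]) auto
  next
    case False
    then obtain S where S: "S \<in> \<F>" "S \<subseteq> D" "t \<notin> S" by blast
    obtain s where s: "s \<in> S" using assms(5) S(1) by blast
    define C where "C = {y. (s, y) \<in> reach T (- {t})}"
    have SC: "S \<subseteq> C"
    proof
      fix y assume "y \<in> S"
      then have "(s, y) \<in> reach T S" using assms(5) S(1) s connected_inD by metis
      then show "y \<in> C" using reach_mono[of T T S "- {t}"] S(3) unfolding C_def by auto
    qed
    \<comment> \<open>A walk that avoids \<open>t\<close> stays in \<open>D\<close>, because every
      edge leaving \<open>D\<close> starts at \<open>t\<close>.\<close>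
    have CD: "y \<in> D - {t}" if "(s, y) \<in> reach T (- {t})" for y
      using that by (induction rule: reach_induct) (use s S boundary in auto)
    have out: "b = t" if "(a, b) \<in> adj T" "a \<in> C" "b \<notin> C" for a b
    proof (rule ccontr)
      assume "b \<noteq> t"
      moreover have sa: "(s, a) \<in> reach T (- {t})" using that(2) unfolding C_def by simp
      moreover have "a \<noteq> t" using CD[OF sa] by simp
      ultimately have "(s, b) \<in> reach T (- {t})" using reach_trans[OF sa reach_adj[OF that(1)]] by simp
      then show False using that(3) unfolding C_def by simp
    qed
    have root: "a = a'" if "(a, t) \<in> adj T" "(a', t) \<in> adj T" "a \<in> C" "a' \<in> C" for a a'
    proof (rule tree_no_bypass[OF assms(1) adj_sym[OF that(1)] adj_sym[OF that(2)]])
      have "(s, a) \<in> reach T (- {t})" "(s, a') \<in> reach T (- {t})"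
        using that(3,4) unfolding C_def by simp_all
      then show "(a, a') \<in> reach T (- {t})" using reach_sym reach_trans by metis
    qed
    \<comment> \<open>The new root is the only vertex of \<open>C\<close> adjacent to
      \<open>t\<close>; if there is none, no edge leaves \<open>C\<close> and any of its vertices
      serves.\<close>
    have "\<exists>t'\<in>C. \<forall>a b. (a, b) \<in> adj T \<longrightarrow> a \<in> C \<longrightarrow> b \<notin> C \<longrightarrow> a = t'"
      using out root s SC by (metis subsetD)
    then obtain t' where t': "t' \<in> C" "\<And>a b. (a, b) \<in> adj T \<Longrightarrow> a \<in> C \<Longrightarrow> b \<notin> C \<Longrightarrow> a = t'"
      by blast
    have "C \<subseteq> D - {t}" using CD unfolding C_def by auto
    then have "C \<subset> D" using psubset.prems(1) by auto
    then show ?thesis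
    proof (rule psubset.IH[OF _ t'])
      show "\<exists>S\<in>\<F>. S \<subseteq> C" using SC S(1) by auto
    qed
  qed
qed

section \<open>Tree decompositions with small bags\<close>

text \<open>A single node whose bag is the whole vertex set suffices. This ensures that the minimum
  in \<open>treewidth\<close> is attained.\<close>

lemma tree_decomposition_exists:
  fixes G :: "('v, 'e) mgraph"
  assumes "multigraph G"
  shows "\<exists>(T :: (nat, nat) mgraph) bag. tree_decomposition G T bag"
proof -
  define T :: "(nat, nat) mgraph" where "T = \<lparr>verts = {0}, edges = {}, ends = (\<lambda>_. {})\<rparr>"
  have path: "is_path H v v ([v], [])" if "v \<in> verts H" for H :: "(nat, nat) mgraph" and v
    using that by (simp add: is_path_single)
  have "connected_graph T"
    unfolding connected_graph_def using path[of 0 T] by (auto simp: T_def)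
  moreover have "\<not> is_cycle T c" for c
    unfolding is_cycle_def T_def by (cases c) auto
  ultimately have "is_tree T"
    unfolding is_tree_def multigraph_def by (auto simp: T_def)
  moreover have "connected_graph (induced_subgraph T {t. v \<in> verts G})" if "v \<in> verts G" for v
    unfolding connected_graph_def using path[of 0 "induced_subgraph T {t. v \<in> verts G}"] that
    by (auto simp: T_def induced_subgraph_def)
  moreover have "\<forall>e\<in>edges G. ends G e \<subseteq> verts G" using assms unfolding multigraph_def by blast
  ultimately have "tree_decomposition G T (\<lambda>_. verts G)"
    unfolding tree_decomposition_def by (auto simp: T_def)
  then show ?thesis by blast
qed

lemma treewidth_bags:
  assumes "multigraph G" "treewidth G \<le> w"
  obtains T :: "(nat, nat) mgraph" and bag where "tree_decomposition G T bag"
    "\<And>t. t \<in> verts T \<Longrightarrow> card (bag t) \<le> w + 1"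
proof -
  have "\<exists>k. \<exists>(T :: (nat, nat) mgraph) bag. tree_decomposition G T bag \<and> decomposition_width T bag = k"
    using tree_decomposition_exists[OF assms(1)] by blast
  then have "\<exists>(T :: (nat, nat) mgraph) bag.
      tree_decomposition G T bag \<and> decomposition_width T bag = treewidth G"
    unfolding treewidth_def by (rule LeastI_ex)
  then obtain T :: "(nat, nat) mgraph" and bag
    where T: "tree_decomposition G T bag" "decomposition_width T bag = treewidth G" by blast
  have "card (bag t) \<le> w + 1" if "t \<in> verts T" for t
  proof -
    have "finite (verts T)"
      using T(1) unfolding tree_decomposition_def is_tree_def multigraph_def by blast
    then have "card (bag t) \<le> Max ((\<lambda>t. card (bag t)) ` verts T)" using that by simp
    \<comment> \<open>A maximum whose truncated predecessor is at most \<open>w\<close> is at most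
      \<open>w + 1\<close>, also when the maximum is 0.\<close>
    then show ?thesis using T(2) assms(2) unfolding decomposition_width_def by linarith
  qed
  then show ?thesis using that T(1) by blast
qed

text \<open>The nodes whose bags contain a fixed vertex form a subtree, and the subtrees of adjacent
  vertices share a node that covers the edge; a walk in \<open>B\<close> links these
  subtrees.\<close>

lemma tree_decomposition_connected:
  assumes "tree_decomposition G T bag" "multigraph G" "B \<subseteq> verts G" "connected_in G B"
  shows "connected_in T {t \<in> verts T. bag t \<inter> B \<noteq> {}}" (is "connected_in T ?N")
proof -
  have vertex: "(s, t) \<in> reach T ?N"
    if "v \<in> B" "s \<in> verts T" "t \<in> verts T" "v \<in> bag s" "v \<in> bag t" for v s t
  proof -
    let ?I = "induced_subgraph T {t. v \<in> bag t}"
    have "connected_graph ?I" using assms(1,3) that unfolding tree_decomposition_def by blast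
    moreover have "s \<in> verts ?I" "t \<in> verts ?I" using that by (auto simp: induced_subgraph_def)
    ultimately have "(s, t) \<in> reach ?I (verts ?I)" by (metis connected_inD connected_graph_imp)
    moreover have "adj ?I \<subseteq> adj T" "verts ?I \<subseteq> ?N"
      using that by (auto simp: induced_subgraph_def adj_def)
    ultimately show ?thesis using reach_mono by blast
  qed
  have "(s, t) \<in> reach T ?N" if st: "s \<in> ?N" "t \<in> ?N" for s t
  proof -
    obtain v u where v: "v \<in> B" "v \<in> bag s" "s \<in> verts T" and u: "u \<in> B" "u \<in> bag t" "t \<in> verts T"
      using st by blast
    \<comment> \<open>All nodes \<open>r\<close> for the current vertex are needed, since the next
      edge of the walk may be covered at any of them.\<close>
    have "\<forall>r. r \<in> verts T \<longrightarrow> u \<in> bag r \<longrightarrow> (s, r) \<in> reach T ?N"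
      using connected_inD[OF assms(4) v(1) u(1)]
    proof (induction rule: reach_induct)
      case refl
      then show ?case using vertex v by blast
    next
      case (step a b)
      obtain e where "e \<in> edges G" "ends G e = {a, b}" using step(2) unfolding adj_def by auto
      then obtain q where q: "q \<in> verts T" "a \<in> bag q" "b \<in> bag q"
        using assms(1) unfolding tree_decomposition_def by fastforce
      then have "(s, q) \<in> reach T ?N" using step(5) by simp
      moreover have "(q, r) \<in> reach T ?N" if "r \<in> verts T" "b \<in> bag r" for r
        using vertex[OF step(4)] q that by simp
      ultimately show ?case using reach_trans[of s q T ?N] by simp
    qed
    then show ?thesis using u by blast
  qed
  then show ?thesis unfolding connected_in_def by auto
qed

definition touching :: "('v, 'e) mgraph \<Rightarrow> 'v set \<Rightarrow> 'v set \<Rightarrow> bool" where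
  "touching G B B' \<longleftrightarrow> (\<exists>a\<in>B. \<exists>b\<in>B'. (a, b) \<in> adj G)"

text \<open>The members of \<open>\<F>\<close> are the branch sets of a minor of \<open>G\<close>.\<close>

lemma treewidth_minor_degree:
  assumes "multigraph G" "treewidth G \<le> w" "\<F> \<noteq> {}" "pairwise disjnt \<F>"
    and \<F>: "\<And>B. B \<in> \<F> \<Longrightarrow> B \<noteq> {} \<and> B \<subseteq> verts G \<and> connected_in G B"
  shows "\<exists>B\<in>\<F>. card {B'\<in>\<F>. B' \<noteq> B \<and> touching G B B'} \<le> w"
proof -
  obtain T :: "(nat, nat) mgraph" and bag where T: "tree_decomposition G T bag"
    and width: "\<And>t. t \<in> verts T \<Longrightarrow> card (bag t) \<le> w + 1"
    using treewidth_bags assms(1,2) by blast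
  define N where "N B = {t \<in> verts T. bag t \<inter> B \<noteq> {}}" for B
  have tree: "is_tree T" and cover: "(\<Union>t\<in>verts T. bag t) = verts G"
    using T unfolding tree_decomposition_def by auto
  have finG: "finite (verts G)" using assms(1) unfolding multigraph_def by blast
  have fin: "finite \<F>" using \<F> finG by (meson Pow_iff finite_Pow_iff finite_subset subsetI)
  have finT: "finite (verts T)" and "verts T \<noteq> {}"
    using tree unfolding is_tree_def multigraph_def connected_graph_def by auto
  then obtain t where "t \<in> verts T" by blast
  moreover have "connected_in T S \<and> S \<noteq> {}" if SN: "S \<in> N ` \<F>" for S
  proof -
    obtain B where B: "B \<in> \<F>" "S = N B" using SN by blast
    then obtain b where "b \<in> B" "b \<in> verts G" using \<F> by blast
    then have "N B \<noteq> {}" using cover unfolding N_def by blast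
    moreover have "connected_in T (N B)"
      unfolding N_def using \<F>[OF B(1)] by (intro tree_decomposition_connected[OF T assms(1)]) auto
    ultimately show ?thesis using B(2) by simp
  qed
  moreover have "\<exists>S\<in>N ` \<F>. S \<subseteq> verts T" using assms(3) unfolding N_def by auto
  \<comment> \<open>Vacuous: no edge leaves \<open>verts T\<close>, so the whole tree is a branch
    and any node may be its root.\<close>
  moreover have "a = t" if "(a, b) \<in> adj T" "a \<in> verts T" "b \<notin> verts T" for a b
    using that adjD tree unfolding is_tree_def by metis
  ultimately have "\<exists>S\<in>N ` \<F>. \<exists>z\<in>S. \<forall>S'\<in>N ` \<F>. S' \<inter> S \<noteq> {} \<longrightarrow> z \<in> S'"
    by (intro subtree_family_simplicial[OF tree finT]) auto
  then obtain B z where B: "B \<in> \<F>" "z \<in> N B"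
    and z: "\<And>B'. B' \<in> \<F> \<Longrightarrow> N B' \<inter> N B \<noteq> {} \<Longrightarrow> z \<in> N B'" by auto
  define \<A> where "\<A> = {B'\<in>\<F>. B' \<noteq> B \<and> touching G B B'}"
  have \<A>: "\<A> \<subseteq> \<F>" "B \<notin> \<A>" "finite \<A>" using fin unfolding \<A>_def by auto
  have "z \<in> N B'" if B': "B' \<in> \<A>" for B'
  proof -
    obtain a b e where "a \<in> B" "b \<in> B'" "e \<in> edges G" "ends G e = {a, b}"
      using B' unfolding \<A>_def touching_def adj_def by auto
    moreover from this obtain t where "t \<in> verts T" "a \<in> bag t" "b \<in> bag t"
      using T unfolding tree_decomposition_def by fastforce
    ultimately have "N B' \<inter> N B \<noteq> {}" unfolding N_def by blast
    then show ?thesis using z[of B'] \<A>(1) that by auto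
  qed
  then have "\<forall>B'\<in>insert B \<A>. \<exists>v. v \<in> bag z \<inter> B'" using B unfolding N_def by auto
  \<comment> \<open>One vertex of the bag is chosen in each branch set. Disjointness makes the
    choice injective, so \<open>B\<close> and its neighbours together number at most
    \<open>w + 1\<close>.\<close>
  then obtain f where f: "\<And>B'. B' \<in> insert B \<A> \<Longrightarrow> f B' \<in> bag z \<inter> B'" by metis
  have "inj_on f (insert B \<A>)"
  proof (rule inj_onI)
    fix X Y assume XY: "X \<in> insert B \<A>" "Y \<in> insert B \<A>" "f X = f Y"
    then have "\<not> disjnt X Y" using f unfolding disjnt_iff by (metis IntD2)
    then show "X = Y" using XY \<A>(1) B(1) assms(4) unfolding pairwise_def by blast
  qed
  moreover have zT: "z \<in> verts T" using B unfolding N_def by blast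
  moreover have "finite (bag z)" using zT cover finG by (metis UN_upper finite_subset)
  ultimately have "card (insert B \<A>) \<le> card (bag z)"
    using f by (intro card_inj_on_le[of f]) auto
  then have "card \<A> \<le> w" using width[OF zT] \<A> by simp
  then show ?thesis using B(1) unfolding \<A>_def by (intro bexI[of _ B]) simp_all
qed

section \<open>Pendant Steiner trees\<close>

lemma subgraph_adj: "subgraph H G \<Longrightarrow> adj H \<subseteq> adj G"
  unfolding subgraph_def adj_def by auto

text \<open>Since some leaf exists, \<open>x\<close> is not the only vertex, so as a non-leaf it has
  two neighbours. The leaves found beyond these by \<open>leaf_beyond\<close> are separated by
  \<open>x\<close>.\<close>

lemma inner_vertex_separates_leaves:
  assumes "is_tree T" "x \<in> verts T" "x \<notin> leaves T" "leaves T \<noteq> {}"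
  obtains u v where "u \<in> leaves T" "v \<in> leaves T" "(u, v) \<notin> reach T (- {x})"
proof -
  have m: "multigraph T" using assms(1) unfolding is_tree_def by blast
  obtain r where r: "r \<in> leaves T" "r \<in> verts T" using assms(4) unfolding leaves_def by blast
  obtain vs es where "is_path T x r (vs, es)"
    using assms(1,2) r connected_graph_path unfolding is_tree_def by metis
  then have "\<exists>c. (x, c) \<in> adj T"
    by (cases rule: is_path_cases) (use r assms(3) in \<open>auto simp: adj_def\<close>)
  then obtain c where c: "(x, c) \<in> adj T" by blast
  then obtain d where d: "(x, d) \<in> adj T" "d \<noteq> c" using leafI assms(1,3) by metis
  obtain u where u: "u \<in> leaves T" "(c, u) \<in> reach T (- {x})"
    using leaf_beyond[OF assms(1) c] by blast
  obtain v where v: "v \<in> leaves T" "(d, v) \<in> reach T (- {x})"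
    using leaf_beyond[OF assms(1) d(1)] by blast
  have "(u, v) \<notin> reach T (- {x})"
  proof
    assume "(u, v) \<in> reach T (- {x})"
    then have "(c, d) \<in> reach T (- {x})"
      using reach_trans[OF reach_trans[OF u(2)] reach_sym[OF v(2)]] by simp
    then show False using tree_no_bypass[OF assms(1) c d(1)] d(2) by simp
  qed
  then show ?thesis using that u v by blast
qed

text \<open>A tree path missing \<open>x\<close> would itself witness reachability outside
  \<open>x\<close>.\<close>

lemma tree_path_inner:
  assumes "is_tree T" "u \<in> verts T" "v \<in> verts T" "(u, v) \<notin> reach T (- {x})" "x \<noteq> u" "x \<noteq> v"
  shows "x \<in> inner_verts (tree_path T u v)"
proof -
  obtain vs es where p: "tree_path T u v = (vs, es)" by fastforce
  then have path: "is_path T u v (vs, es)" using tree_path_is_path assms(1-3) by metis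
  then have "x \<in> set vs" using path_reach[OF path, of "- {x}"] assms(4) by blast
  moreover have "hd vs = u" "last vs = v" using path unfolding is_path_def by auto
  ultimately show ?thesis using p assms(5,6) unfolding inner_verts_def by auto
qed

text \<open>A common inner vertex \<open>x\<close> splits \<open>R\<close> nontrivially in both trees, and two nontrivial
  equivalence relations do not cover \<open>R \<times> R\<close>; hence \<open>x\<close> is inner on both paths of some pair.\<close>

lemma pendant_CIST_inner_disjoint:
  assumes "pendant_CIST G R \<T>" "S \<in> \<T>" "T \<in> \<T>" "S \<noteq> T" "R \<noteq> {}"
  shows "(verts S - R) \<inter> (verts T - R) = {}"
proof (rule ccontr)
  assume "\<not> ?thesis"
  then obtain x where x: "x \<in> verts S" "x \<in> verts T" "x \<notin> R" by blast
  have S: "is_tree S" "leaves S = R" "R \<subseteq> verts S" and T: "is_tree T" "leaves T = R" "R \<subseteq> verts T"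
    using assms unfolding pendant_CIST_def CIST_def steiner_tree_def pendant_def by auto
  have inner: "(u, v) \<in> reach S (- {x}) \<or> (u, v) \<in> reach T (- {x})" if "u \<in> R" "v \<in> R" for u v
  proof (rule ccontr)
    assume not: "\<not> ?thesis"
    then have "u \<noteq> v" using reach_refl by metis
    moreover have "x \<in> inner_verts (tree_path S u v)" "x \<in> inner_verts (tree_path T u v)"
      using tree_path_inner S T not that x by (metis subsetD)+
    ultimately show False
      using assms(1-4) that unfolding pendant_CIST_def CIST_def internally_disjoint_def by blast
  qed
  obtain u v where uv: "u \<in> R" "v \<in> R" "(u, v) \<notin> reach S (- {x})"
    using inner_vertex_separates_leaves S x assms(5) by metis
  \<comment> \<open>In \<open>S\<close> the terminal \<open>y\<close> is apart from \<open>u\<close>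
    or from \<open>v\<close>. In the first case \<open>T\<close> joins \<open>u\<close> to
    \<open>y\<close> directly, in the second through \<open>v\<close>.\<close>
  have "(u, y) \<in> reach T (- {x})" if "y \<in> R" for y
  proof (cases "(u, y) \<in> reach S (- {x})")
    case True
    then have "(v, y) \<notin> reach S (- {x})" using uv(3) by (metis reach_sym reach_trans)
    then show ?thesis using inner uv that by (metis reach_trans)
  qed (use inner uv that in blast)
  then have "(a, b) \<in> reach T (- {x})" if "a \<in> R" "b \<in> R" for a b
    using that by (metis reach_sym reach_trans)
  then show False using inner_vertex_separates_leaves T x assms(5) by metis
qed

text \<open>Two adjacent leaves have no other neighbours, so connectedness leaves nothing else. In a
  pendant tree this applies to any edge between terminals.\<close>

lemma adjacent_leaves:
  assumes "is_tree T" "e \<in> edges T" "ends T e \<subseteq> leaves T"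
  shows "verts T = ends T e" "edges T = {e}"
proof -
  have m: "multigraph T" using assms(1) unfolding is_tree_def by blast
  then have "card (ends T e) = 2" using assms(2) unfolding multigraph_def by blast
  then obtain r s where rs: "ends T e = {r, s}" "r \<noteq> s" by (auto simp: card_2_iff)
  have adj: "(r, s) \<in> adj T" using rs assms(2) unfolding adj_def by auto
  have sub: "ends T e \<subseteq> verts T" using m assms(2) unfolding multigraph_def by blast
  have "v \<in> {r, s}" if "v \<in> verts T" for v
  proof -
    have "(r, v) \<in> reach T (verts T)"
      using connected_inD[OF connected_graph_imp[of T]] assms(1) that rs sub
      unfolding is_tree_def by simp
    then show ?thesis
    proof (induction rule: reach_induct)
      case (step a b)
      have "r \<in> leaves T" "s \<in> leaves T" using assms(3) rs(1) by auto
      then show ?case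
        using leaf_nbr_unique[of r T b s] leaf_nbr_unique[of s T b r] step(2,5) adj adj_sym[OF adj]
        by auto
    qed simp
  qed
  then show verts: "verts T = ends T e" using rs sub by blast
  have "f = e" if f: "f \<in> edges T" for f
  proof -
    have "ends T f \<subseteq> ends T e" "card (ends T f) = 2"
      using m f verts unfolding multigraph_def by auto
    then have "ends T f = ends T e" using rs by (intro card_subset_eq) auto
    then show ?thesis using tree_no_parallel assms(1,2) f by metis
  qed
  then show "edges T = {e}" using assms(2) by blast
qed

text \<open>The neighbour of a leaf is inner, as no edge joins two leaves. Both directions are
  stated because they serve degree counts at different branch sets.\<close>

lemma leaf_touches_inner:
  assumes "is_tree T" "r \<in> leaves T" "\<And>e. e \<in> edges T \<Longrightarrow> \<not> ends T e \<subseteq> leaves T"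
  shows "touching T (verts T - leaves T) {r}" "touching T {r} (verts T - leaves T)"
proof -
  have m: "multigraph T" using assms(1) unfolding is_tree_def by blast
  obtain y where y: "(r, y) \<in> adj T" using leaf_nbr m assms(2) by metis
  then have "y \<in> verts T - leaves T"
    using adjD[OF m y] assms(2,3) unfolding adj_def by force
  then show "touching T (verts T - leaves T) {r}" "touching T {r} (verts T - leaves T)"
    using y adj_sym[OF y] unfolding touching_def by auto
qed

lemma touching_mono: "subgraph H G \<Longrightarrow> touching H A B \<Longrightarrow> touching G A B"
  using subgraph_adj unfolding touching_def by blast

lemma connected_in_singleton: "connected_in G {v}"
  unfolding connected_in_def by (auto simp: reach_refl)

text \<open>The hypothesis \<open>no_parallel_terminal_edges\<close> excludes a counterexample: for
  two terminals joined by two parallel edges the treewidth is 1, yet each edge alone is a pendant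
  tree and the two form a pendant CIST of size 2.\<close>

theorem theorem3p20:
  fixes G :: "('v, 'e) mgraph" and R :: "'v set" and w :: nat and \<T> :: "('v, 'e) mgraph set"
  assumes "multigraph G" and "connected_graph G"
    and "treewidth G \<le> w"
    and "R \<subseteq> verts G" and "w + 1 \<le> card R"
    and no_parallel_terminal_edges:
      "w = 1 \<Longrightarrow> card R = 2 \<Longrightarrow> card {e \<in> edges G. ends G e = R} \<le> 1"
    and "pendant_CIST G R \<T>"
  shows "card \<T> \<le> w"
proof (rule ccontr)
  assume large: "\<not> ?thesis"
  \<comment> \<open>Infinite sets have cardinality 0, so a positive cardinality gives both
    finiteness and nonemptiness; the same applies to \<open>\<T>\<close> below.\<close>
  have R: "finite R" "R \<noteq> {}" using assms(5) card.infinite by fastforce+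
  have tree: "is_tree T" and leaves: "leaves T = R" and sub: "subgraph T G" and RT: "R \<subseteq> verts T"
    if "T \<in> \<T>" for T
    using assms(7) that unfolding pendant_CIST_def CIST_def steiner_tree_def pendant_def by auto
  have fin: "finite \<T>" "\<T> \<noteq> {}" using large card.infinite by fastforce+
  \<comment> \<open>For the trees of the CIST the leaves are exactly \<open>R\<close>, so this is
    the set of inner vertices; it is empty for a single edge.\<close>
  define I where "I T = verts T - R" for T :: "('v, 'e) mgraph"
  have I: "I T \<subseteq> verts G" "connected_in G (I T)" if "T \<in> \<T>" for T
  proof -
    show "I T \<subseteq> verts G" using sub[OF that] unfolding subgraph_def I_def by blast
    have "connected_in T (I T)"
      using connected_in_inner[OF tree[OF that]] leaves[OF that] unfolding I_def by simp
    then show "connected_in G (I T)"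
      unfolding connected_in_def using reach_mono[OF subgraph_adj[OF sub[OF that]]] by blast
  qed
  have I_disj: "disjnt (I S) (I T)" if "S \<in> \<T>" "T \<in> \<T>" "S \<noteq> T" for S T
    using pendant_CIST_inner_disjoint[OF assms(7) that R(2)] unfolding I_def disjnt_def .
  have I_R: "disjnt (I T) {r}" "disjnt {r} (I T)" if "r \<in> R" for T r
    using that unfolding I_def disjnt_def by auto
  have touch: "touching G (I T) {r}" "touching G {r} (I T)"
    if "T \<in> \<T>" "r \<in> R" "\<And>e. e \<in> edges T \<Longrightarrow> \<not> ends T e \<subseteq> R" for T r
    using leaf_touches_inner[of T r] touching_mono sub tree leaves that unfolding I_def by metis+
  have I_ne: "I T \<noteq> {}" if "T \<in> \<T>" "\<And>e. e \<in> edges T \<Longrightarrow> \<not> ends T e \<subseteq> R" for T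
    using touch[OF that(1) _ that(2)] R(2) unfolding touching_def by blast
  show False
  proof (cases "\<exists>T\<in>\<T>. \<exists>e\<in>edges T. ends T e \<subseteq> R")
    case False
    \<comment> \<open>This minor contains a complete bipartite graph between trees and terminals: a
      tree has degree at least \<open>card R\<close>, a terminal at least \<open>card \<T>\<close>,
      and both exceed \<open>w\<close>.\<close>
    define \<F> where "\<F> = I ` \<T> \<union> (\<lambda>r. {r}) ` R"
    have no: "\<And>e. e \<in> edges T \<Longrightarrow> \<not> ends T e \<subseteq> R" if "T \<in> \<T>" for T using False that by blast
    have "inj_on I \<T>" using I_disj I_ne no unfolding inj_on_def disjnt_def by (metis Int_absorb)
    then have cI: "card (I ` \<T>) = card \<T>" by (rule card_image)
    have cR: "card ((\<lambda>r. {r}) ` R) = card R" by (rule card_image) simp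
    have finF: "finite \<F>" using fin R unfolding \<F>_def by simp
    have "pairwise disjnt \<F>"
      unfolding pairwise_def \<F>_def using I_disj I_R by (auto simp: disjnt_def)
    moreover have "B \<noteq> {} \<and> B \<subseteq> verts G \<and> connected_in G B" if "B \<in> \<F>" for B
      using that I I_ne no assms(4) connected_in_singleton unfolding \<F>_def by auto
    moreover have "\<F> \<noteq> {}" using R unfolding \<F>_def by blast
    ultimately obtain B where B: "B \<in> \<F>" "card {B'\<in>\<F>. B' \<noteq> B \<and> touching G B B'} \<le> w"
      using treewidth_minor_degree[OF assms(1,3)] by blast
    consider T where "T \<in> \<T>" "B = I T" | r where "r \<in> R" "B = {r}" using B(1) unfolding \<F>_def by blast
    then show False
    proof cases
      case 1
      have "(\<lambda>r. {r}) ` R \<subseteq> {B'\<in>\<F>. B' \<noteq> B \<and> touching G B B'}"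
        using 1 touch no unfolding \<F>_def I_def by blast
      then have "card ((\<lambda>r. {r}) ` R) \<le> card {B'\<in>\<F>. B' \<noteq> B \<and> touching G B B'}"
        using finF by (intro card_mono) auto
      then have "card R \<le> w" using B(2) cR by linarith
      then show False using assms(5) by simp
    next
      case 2
      have "I ` \<T> \<subseteq> {B'\<in>\<F>. B' \<noteq> B \<and> touching G B B'}"
        using 2 touch no unfolding \<F>_def I_def by blast
      then have "card (I ` \<T>) \<le> card {B'\<in>\<F>. B' \<noteq> B \<and> touching G B B'}"
        using finF by (intro card_mono) auto
      then have "card \<T> \<le> w" using B(2) cI by linarith
      then show False using large by simp
    qed
  next
    case True
    then obtain T e where T: "T \<in> \<T>" "e \<in> edges T" "ends T e \<subseteq> R" by blast
    \<comment> \<open>A tree with an edge inside \<open>R\<close> is that single edge, and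
      \<open>R\<close> consists of its two ends; thus only \<open>w\<close> at most 1 remains
      possible.\<close>
    have shape: "verts S = R" "edges S = {f}" "ends G f = R" "f \<in> edges G"
      if S: "S \<in> \<T>" "f \<in> edges S" "ends S f \<subseteq> R" for S f
    proof -
      note adjacent_leaves[OF tree[OF S(1)] S(2)]
      then have "verts S = ends S f" "edges S = {f}" using S leaves by auto
      moreover from this have "ends S f = R" using RT[OF S(1)] S(3) by blast
      ultimately show "verts S = R" "edges S = {f}" "ends G f = R" "f \<in> edges G"
        using sub[OF S(1)] S(2) unfolding subgraph_def by auto
    qed
    have eR: "ends G e = R" "e \<in> edges G" using shape T by blast+
    then have "card R = 2" using assms(1) unfolding multigraph_def by blast
    then obtain r s where rs: "R = {r, s}" "r \<noteq> s" by (auto simp: card_2_iff)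
    have "(r, s) \<in> adj G" using eR rs unfolding adj_def by auto
    then have rs_touch: "touching G {r} {s}" "touching G {s} {r}"
      using adj_sym unfolding touching_def by auto
    \<comment> \<open>The edge between the terminals is a minor with both degrees equal to
      1.\<close>
    have "w \<noteq> 0"
    proof
      assume "w = 0"
      define deg where "deg B = card {B'\<in>{{r}, {s}}. B' \<noteq> B \<and> touching G B B'}" for B
      have "\<exists>B\<in>{{r}, {s}}. deg B \<le> w"
        unfolding deg_def
      proof (rule treewidth_minor_degree[OF assms(1,3)])
        show "pairwise disjnt {{r}, {s}}" using rs(2) by (simp add: pairwise_insert)
        show "B \<noteq> {} \<and> B \<subseteq> verts G \<and> connected_in G B" if "B \<in> {{r}, {s}}" for B
          using that rs(1) assms(4) connected_in_singleton by auto
      qed simp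
      moreover have "{B'\<in>{{r}, {s}}. B' \<noteq> {r} \<and> touching G {r} B'} = {{s}}"
        "{B'\<in>{{r}, {s}}. B' \<noteq> {s} \<and> touching G {s} B'} = {{r}}"
        using rs(2) rs_touch by auto
      then have "deg {r} = 1" "deg {s} = 1" unfolding deg_def by simp_all
      ultimately show False using \<open>w = 0\<close> by simp
    qed
    then have w: "w = 1" using assms(5) \<open>card R = 2\<close> by simp
    have "\<exists>S\<in>\<T>. S \<noteq> T"
    proof (rule ccontr)
      assume "\<not> ?thesis"
      then have "\<T> \<subseteq> {T}" by blast
      then show False using large w card_mono[of "{T}" \<T>] by simp
    qed
    then obtain S where S: "S \<in> \<T>" "S \<noteq> T" by blast
    \<comment> \<open>A second tree with an edge inside \<open>R\<close> would be a single edge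
      parallel to \<open>e\<close>, hence \<open>e\<close> itself by hypothesis. Then it equals
      \<open>T\<close> as a record, since both trees share the function \<open>ends\<close> of
      \<open>G\<close>.\<close>
    have no: "\<not> ends S f \<subseteq> R" if f: "f \<in> edges S" for f
    proof
      assume fR: "ends S f \<subseteq> R"
      define P where "P = {e \<in> edges G. ends G e = R}"
      have "card P \<le> Suc 0" using no_parallel_terminal_edges w \<open>card R = 2\<close> unfolding P_def by simp
      moreover have "finite P" using assms(1) unfolding multigraph_def P_def by simp
      ultimately have "\<forall>a\<in>P. \<forall>b\<in>P. a = b" using card_le_Suc0_iff_eq by blast
      moreover have "e \<in> P" "f \<in> P" using eR shape(3,4)[OF S(1) f fR] unfolding P_def by simp_all
      ultimately have "e = f" by blast
      then have "verts S = verts T" "edges S = edges T" "ends S = ends T"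
        using shape[OF S(1) f fR] shape[OF T] sub S(1) T(1) unfolding subgraph_def by auto
      then show False using S(2) by simp
    qed
    \<comment> \<open>The branch sets form a triangle: \<open>S\<close> has inner vertices next to
      both terminals, and \<open>e\<close> joins the terminals. All degrees are 2, above
      \<open>w = 1\<close>.\<close>
    define \<F> where "\<F> = {I S, {r}, {s}}"
    have distinct: "I S \<noteq> {r}" "I S \<noteq> {s}" using rs unfolding I_def by auto
    have St: "touching G (I S) {r}" "touching G {r} (I S)" "touching G (I S) {s}" "touching G {s} (I S)"
      using touch[OF S(1) _ no] rs by auto
    define deg where "deg B = card {B'\<in>\<F>. B' \<noteq> B \<and> touching G B B'}" for B
    have "\<exists>B\<in>\<F>. deg B \<le> w"
      unfolding deg_def
    proof (rule treewidth_minor_degree[OF assms(1,3)])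
      show "pairwise disjnt \<F>"
        unfolding \<F>_def using I_R[of r S] I_R[of s S] rs by (auto simp: pairwise_insert)
      show "B \<noteq> {} \<and> B \<subseteq> verts G \<and> connected_in G B" if "B \<in> \<F>" for B
        using that I[OF S(1)] I_ne[OF S(1) no] assms(4) rs connected_in_singleton unfolding \<F>_def by auto
    qed (simp add: \<F>_def)
    moreover have "{B'\<in>\<F>. B' \<noteq> I S \<and> touching G (I S) B'} = {{r}, {s}}"
      "{B'\<in>\<F>. B' \<noteq> {r} \<and> touching G {r} B'} = {I S, {s}}"
      "{B'\<in>\<F>. B' \<noteq> {s} \<and> touching G {s} B'} = {I S, {r}}"
      using rs(2) rs_touch St distinct unfolding \<F>_def by auto
    then have "deg (I S) = 2" "deg {r} = 2" "deg {s} = 2"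
      unfolding deg_def using distinct rs(2) by simp_all
    ultimately show False using w unfolding \<F>_def by simp
  qed
qed

end
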